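(* Let $n\ge 1$ and let $\Sigma$ be an $[\underline{\ell_\infty},\ell_1,\dots,\ell_t]$-starter over $\mathbb{Z}_{2n}$. Then (1) there is a $2$-pyramidal solution to $OP^-([\ell_\infty+1,\ell_1,\dots,\ell_t])$, i.e. a $2$-pyramidal factorization of $K_{2n+2}-I$, for some $1$-factor $I$ of $K_{2n+2}$, into copies of the $2$-regular graph with cycles of lengths $\ell_\infty+1,\ell_1,\dots,\ell_t$; (2) there is a regular solution to $OP^+([\ell_\infty-1,\ell_1,\dots,\ell_t])$, i.e. a regular factorization of $K_{2n}+J$, for some $1$-factor $J$ of $K_{2n}$, into copies of the $2$-regular graph with cycles of lengths $\ell_\infty-1,\ell_1,\dots,\ell_t$.
   Context: For a graph $\Gamma$ with vertices in $\mathbb{Z}_{2n}\cup\{\infty\}$, $\Delta\Gamma$ is the multiset of all differences $x-y$ (computed in $\mathbb{Z}_{2n}$) over ordered pairs $(x,y)$ of adjacent vertices with $x\ne\infty\ne y$, and $\Gamma+a$ is the graph obtained by replacing each vertex $x\ne\infty$ by $x+a$ (fixing $\infty$). A $2$-starter over $\mathbb{Z}_{2n}$ is a $2$-regular graph $\Sigma$ with vertex set $\mathbb{Z}_{2n}\cup\{\infty\}$ such that $\Delta\Sigma\supseteq\mathbb{Z}_{2n}\setminus\{0\}$ and $\Sigma+n=\Sigma$. It is an $[\underline{\ell_\infty},\ell_1,\dots,\ell_t]$-starter if its cycles have lengths $\ell_\infty,\ell_1,\dots,\ell_t$, where $\ell_\infty$ is the length of the cycle through $\infty$. $K_v+J$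 is the multigraph obtained from $K_v$ by doubling the edges of the $1$-factor $J$. An $F$-factorization of a multigraph is a collection of spanning subgraphs isomorphic to $F$ whose edge multisets partition the edge multiset. A factorization is $f$-pyramidal if it admits an automorphism group (vertex permutations mapping factors onto factors) fixing exactly $f$ vertices and acting sharply transitively on the remaining vertices; regular means $0$-pyramidal. *)

theory Defs
  imports "HOL-Library.Multiset" "HOL-Algebra.Bij"
begin

text \<open>Edges form a multiset of two-element vertex sets, so parallel edges are allowed and
  loops are not (see \<open>multigraph\<close>).\<close>

record 'a mgraph =
  verts :: "'a set"
  edges :: "'a set multiset"

definition multigraph :: "'a mgraph \<Rightarrow> bool" where
  "multigraph G \<longleftrightarrow> finite (verts G) \<and> (\<forall>e \<in># edges G. e \<subseteq> verts G \<and> card e = 2)"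

definition simple_graph :: "'a mgraph \<Rightarrow> bool" where
  "simple_graph G \<longleftrightarrow> multigraph G \<and> (\<forall>e. count (edges G) e \<le> 1)"

definition degree_in :: "'a mgraph \<Rightarrow> 'a \<Rightarrow> nat" where
  "degree_in G v = size {#e \<in># edges G. v \<in> e#}"

definition regular_graph :: "nat \<Rightarrow> 'a mgraph \<Rightarrow> bool" where
  "regular_graph k G \<longleftrightarrow> (\<forall>v \<in> verts G. degree_in G v = k)"

definition spanning_subgraph :: "'a mgraph \<Rightarrow> 'a mgraph \<Rightarrow> bool" where
  "spanning_subgraph H G \<longleftrightarrow> multigraph H \<and> verts H = verts G \<and> edges H \<subseteq># edges G"

definition one_factor :: "'a mgraph \<Rightarrow> 'a mgraph \<Rightarrow> bool" where
  "one_factor I G \<longleftrightarrow> spanning_subgraph I G \<and> regular_graph 1 I"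

definition map_mgraph :: "('a \<Rightarrow> 'b) \<Rightarrow> 'a mgraph \<Rightarrow> 'b mgraph" where
  "map_mgraph f G = \<lparr>verts = f ` verts G, edges = image_mset ((`) f) (edges G)\<rparr>"

definition mgraph_iso :: "('a \<Rightarrow> 'b) \<Rightarrow> 'a mgraph \<Rightarrow> 'b mgraph \<Rightarrow> bool" where
  "mgraph_iso \<phi> G H \<longleftrightarrow> inj_on \<phi> (verts G) \<and> map_mgraph \<phi> G = H"

definition isomorphic :: "'a mgraph \<Rightarrow> 'b mgraph \<Rightarrow> bool" where
  "isomorphic G H \<longleftrightarrow> (\<exists>\<phi>. mgraph_iso \<phi> G H)"

definition complete_mgraph :: "nat \<Rightarrow> nat mgraph" where
  "complete_mgraph v = \<lparr>verts = {..<v}, edges = mset_set {e. e \<subseteq> {..<v} \<and> card e = 2}\<rparr>"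

definition remove_edges :: "'a mgraph \<Rightarrow> 'a mgraph \<Rightarrow> 'a mgraph" where
  "remove_edges G H = \<lparr>verts = verts G, edges = edges G - edges H\<rparr>"

definition add_edges :: "'a mgraph \<Rightarrow> 'a mgraph \<Rightarrow> 'a mgraph" where
  "add_edges G H = \<lparr>verts = verts G, edges = edges G + edges H\<rparr>"

text \<open>The disjoint union of cycles of the given lengths; the vertex \<open>(i, j)\<close> is the \<open>j\<close>-th vertex
  of the \<open>i\<close>-th cycle. A cycle of length 2 is a digon: two vertices joined by two parallel
  edges. Lengths below 2 do not describe cycles and are not meant to occur.\<close>

definition cycles_graph :: "nat list \<Rightarrow> (nat \<times> nat) mgraph" where
  "cycles_graph ls =
    \<lparr>verts = (SIGMA i:{..<length ls}. {..<ls ! i}),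
     edges = image_mset (\<lambda>(i, j). {(i, j), (i, Suc j mod ls ! i)})
               (mset_set (SIGMA i:{..<length ls}. {..<ls ! i}))\<rparr>"

text \<open>The collection of factors is a multiset because in a multigraph a factor may be repeated.\<close>

definition factorization :: "'a mgraph \<Rightarrow> 'b mgraph \<Rightarrow> 'a mgraph multiset \<Rightarrow> bool" where
  "factorization G F \<F> \<longleftrightarrow>
     (\<forall>H \<in># \<F>. spanning_subgraph H G \<and> isomorphic F H) \<and>
     (\<Sum>H \<in># \<F>. edges H) = edges G"

definition sharply_transitive_on :: "('a \<Rightarrow> 'a) set \<Rightarrow> 'a set \<Rightarrow> bool" where
  "sharply_transitive_on A W \<longleftrightarrow> (\<forall>x \<in> W. \<forall>y \<in> W. \<exists>!g. g \<in> A \<and> g x = y)"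

definition fixed_points :: "('a \<Rightarrow> 'a) set \<Rightarrow> 'a set \<Rightarrow> 'a set" where
  "fixed_points A V = {x \<in> V. \<forall>g \<in> A. g x = x}"

definition automorphism_group :: "('a \<Rightarrow> 'a) set \<Rightarrow> 'a set \<Rightarrow> 'a mgraph multiset \<Rightarrow> bool" where
  "automorphism_group A V \<F> \<longleftrightarrow>
     subgroup A (BijGroup V) \<and> (\<forall>g \<in> A. image_mset (map_mgraph g) \<F> = \<F>)"

definition pyramidal_factorization ::
  "nat \<Rightarrow> 'a mgraph \<Rightarrow> 'b mgraph \<Rightarrow> 'a mgraph multiset \<Rightarrow> bool" where
  "pyramidal_factorization f G F \<F> \<longleftrightarrow>
     factorization G F \<F> \<and>
     (\<exists>A. automorphism_group A (verts G) \<F> \<and>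
          card (fixed_points A (verts G)) = f \<and>
          sharply_transitive_on A (verts G - fixed_points A (verts G)))"

definition regular_factorization ::
  "'a mgraph \<Rightarrow> 'b mgraph \<Rightarrow> 'a mgraph multiset \<Rightarrow> bool" where
  "regular_factorization G F \<F> \<longleftrightarrow> pyramidal_factorization 0 G F \<F>"

text \<open>The group of integers modulo \<open>m\<close> is represented by the residues \<open>{0..<m}\<close> with arithmetic
  modulo \<open>m\<close>; \<open>None\<close> plays the role of the point at infinity.\<close>

definition Zmod :: "nat \<Rightarrow> int set" where
  "Zmod m = {0..<int m}"

definition differences :: "nat \<Rightarrow> int option mgraph \<Rightarrow> int multiset" where
  "differences m G =
     image_mset (\<lambda>(x, y). (x - y) mod int m) (mset_set {(x, y). {Some x, Some y} \<in># edges G})"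

definition translate :: "nat \<Rightarrow> int option mgraph \<Rightarrow> int \<Rightarrow> int option mgraph" where
  "translate m G a = map_mgraph (map_option (\<lambda>x. (x + a) mod int m)) G"

definition two_starter :: "nat \<Rightarrow> int option mgraph \<Rightarrow> bool" where
  "two_starter n G \<longleftrightarrow>
     simple_graph G \<and> regular_graph 2 G \<and>
     verts G = insert None (Some ` Zmod (2 * n)) \<and>
     mset_set (Zmod (2 * n) - {0}) \<subseteq># differences (2 * n) G \<and>
     translate (2 * n) G (int n) = G"

text \<open>The first cycle is the one through infinity.\<close>

definition two_starter_of_type :: "nat \<Rightarrow> nat \<Rightarrow> nat list \<Rightarrow> int option mgraph \<Rightarrow> bool" where
  "two_starter_of_type n l ls G \<longleftrightarrow>
     two_starter n G \<and> (\<forall>k \<in> set (l # ls). 3 \<le> k) \<and>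
     (\<exists>\<phi>. mgraph_iso \<phi> (cycles_graph (l # ls)) G \<and> None \<in> \<phi> ` ({0} \<times> {..<l}))"

end

theory Submission
  imports Defs
begin

text \<open>Translation by \<open>n\<close> fixes \<open>\<infinity>\<close> and no other vertex, so it reflects the cycle through \<open>\<infinity>\<close>:
  the neighbours of \<open>\<infinity>\<close> are \<open>a\<close> and \<open>a + n\<close>, and the edge opposite to \<open>\<infinity>\<close> is some \<open>{c, c + n}\<close>.
  By counting, the remaining \<open>2n - 2\<close> edges cover each pair of difference other than \<open>n\<close> exactly
  once under the translations by \<open>0, \<dots>, n - 1\<close>. For (1), subdivide \<open>{c, c + n}\<close> by a new vertex \<open>\<infinity>'\<close>;
  for (2), delete \<open>\<infinity>\<close> and join \<open>a\<close> to \<open>a + n\<close>. The \<open>n\<close> translates of the result are the factors,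
  and \<open>I\<close> and \<open>J\<close> consist of the pairs of difference \<open>n\<close>, with \<open>{\<infinity>, \<infinity>'}\<close> added to \<open>I\<close>.\<close>

section \<open>Cycles given by vertex lists\<close>

fun path_edges :: "'a list \<Rightarrow> 'a set multiset" where
  "path_edges (x # y # zs) = add_mset {x, y} (path_edges (y # zs))"
| "path_edges _ = {#}"

text \<open>Repeating the head at the end turns a cycle into a path, so that
  \<open>path_edges_append\<close> can cut it anywhere. A list of two vertices gives a digon with
  two parallel edges, which is needed when a cycle of length 3 loses a vertex.\<close>

definition cycle_edges :: "'a list \<Rightarrow> 'a set multiset" where
  "cycle_edges xs = path_edges (xs @ [hd xs])"

lemma path_edges_append:
  assumes "xs \<noteq> []" "ys \<noteq> []"
  shows "path_edges (xs @ ys) = path_edges xs + {#{last xs, hd ys}#} + path_edges ys"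
  using assms
proof (induction xs rule: path_edges.induct)
  case ("2_2" x)
  then show ?case by (cases ys) auto
qed auto

lemma path_edges_nth:
  "path_edges xs = image_mset (\<lambda>j. {xs ! j, xs ! Suc j}) (mset_set {..<length xs - 1})"
proof (induction xs rule: path_edges.induct)
  case (1 x y zs)
  have "mset_set {..<Suc (length zs)} = add_mset 0 (image_mset Suc (mset_set {..<length zs}))"
    by (subst lessThan_Suc_eq_insert_0) (simp add: image_mset_mset_set)
  then show ?case using 1 by (simp add: image_mset.compositionality o_def)
qed auto

text \<open>The bridge to \<open>cycles_graph\<close>, whose edges are indexed in this form.\<close>

lemma cycle_edges_nth:
  assumes "xs \<noteq> []"
  shows "cycle_edges xs =
    image_mset (\<lambda>j. {xs ! j, xs ! (Suc j mod length xs)}) (mset_set {..<length xs})"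
  unfolding cycle_edges_def path_edges_nth
proof (simp, intro image_mset_cong)
  fix j assume "j \<in># mset_set {..<length xs}"
  then have "j < length xs" by simp
  then show "{(xs @ [hd xs]) ! j, (xs @ [hd xs]) ! Suc j} = {xs ! j, xs ! (Suc j mod length xs)}"
    using assms by (cases "Suc j = length xs") (auto simp: nth_append hd_conv_nth)
qed

lemma size_cycle_edges: "xs \<noteq> [] \<Longrightarrow> size (cycle_edges xs) = length xs"
  by (simp add: cycle_edges_nth)

text \<open>Both sides consist of the two paths and the two edges joining their ends. This allows a
  cycle to be read starting from infinity.\<close>

lemma cycle_edges_rotate: "cycle_edges (xs @ ys) = cycle_edges (ys @ xs)"
proof (cases "xs = [] \<or> ys = []")
  case False
  then show ?thesis
    by (simp add: cycle_edges_def path_edges_append ac_simps)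
qed auto

lemma cycle_edges_map: "xs \<noteq> [] \<Longrightarrow>
    cycle_edges (map f xs) = image_mset ((`) f) (cycle_edges xs)"
  by (auto simp: cycle_edges_nth image_mset.compositionality o_def intro!: image_mset_cong)

text \<open>Peels off the first cycle, the one to be modified. The other cycles keep their shape and
  only have their index raised by one.\<close>

lemma cycles_graph_Cons:
  assumes "l > 0"
  shows "cycles_graph (l # ls) =
    \<lparr>verts = set (map (Pair 0) [0..<l]) \<union> map_prod Suc id ` verts (cycles_graph ls),
     edges = cycle_edges (map (Pair 0) [0..<l]) +
       image_mset ((`) (map_prod Suc id)) (edges (cycles_graph ls))\<rparr>"
proof -
  let ?S = "SIGMA i:{..<length ls}. {..<ls ! i}"
  have S: "(SIGMA i:{..<length (l # ls)}. {..<(l # ls) ! i}) =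
      Pair 0 ` {..<l} \<union> map_prod Suc id ` ?S" (is "?L = ?R")
  proof (intro equalityI subsetI)
    fix p assume "p \<in> ?L"
    then show "p \<in> ?R"
      by (cases p; cases "fst p") (auto simp: image_iff map_prod_def)
  qed auto
  have inj: "inj_on (map_prod Suc (id :: nat \<Rightarrow> nat)) X" "inj_on (Pair (0 :: nat)) Y"
    for X and Y :: "nat set"
    by (auto simp: inj_on_def)
  have "mset_set ?R = mset_set (Pair 0 ` {..<l}) + mset_set (map_prod Suc id ` ?S)"
    by (rule mset_set_Union) auto
  also have "\<dots> = image_mset (Pair 0) (mset_set {..<l})
      + image_mset (map_prod Suc id) (mset_set ?S)"
    by (simp add: image_mset_mset_set inj)
  finally have R: "mset_set ?R = image_mset (Pair 0) (mset_set {..<l})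
      + image_mset (map_prod Suc id) (mset_set ?S)" .
  show ?thesis
    unfolding cycles_graph_def S R
    using assms
    by (simp add: cycle_edges_nth image_mset.compositionality o_def lessThan_atLeast0
        case_prod_unfold) (auto intro!: image_mset_cong)
qed

lemma verts_map_mgraph [simp]: "verts (map_mgraph f G) = f ` verts G"
  and edges_map_mgraph [simp]: "edges (map_mgraph f G) = image_mset ((`) f) (edges G)"
  by (simp_all add: map_mgraph_def)

lemma map_mgraph_comp: "map_mgraph f (map_mgraph g G) = map_mgraph (f \<circ> g) G"
  by (simp add: map_mgraph_def image_image image_mset.compositionality o_def)

lemma map_mgraph_cong:
  assumes "\<And>e. e \<in># edges G \<Longrightarrow> e \<subseteq> verts G" "\<And>x. x \<in> verts G \<Longrightarrow> f x = g x"
  shows "map_mgraph f G = map_mgraph g G"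
  using assms by (auto simp: map_mgraph_def intro!: image_mset_cong image_cong)

lemma isomorphic_map_mgraph:
  assumes "isomorphic F H" "inj_on f (verts H)"
  shows "isomorphic F (map_mgraph f H)"
proof -
  from assms(1) obtain \<phi> where "inj_on \<phi> (verts F)" "map_mgraph \<phi> F = H"
    by (auto simp: isomorphic_def mgraph_iso_def)
  then have "mgraph_iso (f \<circ> \<phi>) F (map_mgraph f H)"
    using assms(2) by (auto simp: mgraph_iso_def map_mgraph_comp intro!: comp_inj_on)
  then show ?thesis by (auto simp: isomorphic_def)
qed

lemma cycles_graph_edge_subset: "e \<in># edges (cycles_graph ls) \<Longrightarrow> e \<subseteq> verts (cycles_graph ls)"
  by (auto simp: cycles_graph_def)

text \<open>In \<open>cycles_graph\<close> the pair \<open>(i, j)\<close> indexes both a vertex and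
  the edge leaving it, so there are as many edges as vertices. Isomorphisms preserve both
  counts.\<close>

lemma isomorphic_cycles_graph_edges:
  assumes "isomorphic (cycles_graph ls) H"
  shows "finite (verts H)" "size (edges H) = card (verts H)"
    and "\<And>e. e \<in># edges H \<Longrightarrow> e \<subseteq> verts H"
proof -
  from assms obtain \<phi> where \<phi>: "inj_on \<phi> (verts (cycles_graph ls))" "H = map_mgraph \<phi> (cycles_graph ls)"
    by (auto simp: isomorphic_def mgraph_iso_def)
  show "finite (verts H)" unfolding \<phi>(2) by (simp add: cycles_graph_def)
  show "size (edges H) = card (verts H)"
    using card_image[OF \<phi>(1)] unfolding \<phi>(2) by (simp add: cycles_graph_def)
  show "\<And>e. e \<in># edges H \<Longrightarrow> e \<subseteq> verts H"
    using cycles_graph_edge_subset unfolding \<phi>(2) by (auto simp: image_iff)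
qed

text \<open>The isomorphism sends \<open>(0, j)\<close> to \<open>xs ! j\<close> and acts on the
  later cycles as the given one does. Disjointness makes the combined map injective. This is how the
  modified cycle is put back beside the untouched ones.\<close>

lemma isomorphic_cycles_graph_ConsI:
  assumes "distinct xs" "xs \<noteq> []" "length xs = l" "isomorphic (cycles_graph ls) R" "set xs \<inter> verts R = {}"
  shows "isomorphic (cycles_graph (l # ls))
    \<lparr>verts = set xs \<union> verts R, edges = cycle_edges xs + edges R\<rparr>"
proof -
  from assms(4) obtain \<psi> where \<psi>: "inj_on \<psi> (verts (cycles_graph ls))"
      "R = map_mgraph \<psi> (cycles_graph ls)"
    by (auto simp: isomorphic_def mgraph_iso_def)
  define \<phi> where "\<phi> p = (case p of (0, j) \<Rightarrow> xs ! j | (Suc i, j) \<Rightarrow> \<psi> (i, j))" for p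
  have l: "l > 0" using assms by auto
  have 1: "map \<phi> (map (Pair 0) [0..<l]) = xs"
    using assms(3) by (auto simp: \<phi>_def o_def map_nth)
  have 2: "\<phi> \<circ> map_prod Suc id = \<psi>" by (auto simp: \<phi>_def)
  have 3: "\<phi> ` map_prod Suc id ` X = \<psi> ` X" for X
    unfolding 2[symmetric] by (simp only: image_comp)
  have 4: "\<phi> ` set (map (Pair 0) [0..<l]) = set xs"
    using arg_cong[OF 1, of set] by (simp add: image_image)
  have 5: "image_mset ((`) \<phi>) (cycle_edges (map (Pair 0) [0..<l])) = cycle_edges xs"
    using l cycle_edges_map[of "map (Pair 0) [0..<l]" \<phi>] unfolding 1 by simp
  have 6: "image_mset ((`) \<phi>) (image_mset ((`) (map_prod Suc id)) M) = image_mset ((`) \<psi>) M" for M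
    by (simp add: image_mset.compositionality o_def 3)
  have "map_mgraph \<phi> (cycles_graph (l # ls)) =
      \<lparr>verts = set xs \<union> verts R, edges = cycle_edges xs + edges R\<rparr>"
    unfolding cycles_graph_Cons[OF l] map_mgraph_def \<psi>(2) mgraph.select_convs
      image_mset_union image_Un 3 4 5 6 ..
  moreover have "inj_on \<phi> (verts (cycles_graph (l # ls)))"
  proof -
    let ?A = "set (map (Pair 0) [0..<l]) :: (nat \<times> nat) set"
    let ?B = "map_prod Suc id ` verts (cycles_graph ls)"
    have "inj_on \<phi> ?A"
      using assms(1,3) by (auto simp: inj_on_def \<phi>_def nth_eq_iff_index_eq)
    moreover have "inj_on \<phi> ?B"
      using \<psi>(1) unfolding 2[symmetric] by (rule inj_on_imageI)
    moreover have "\<phi> ` ?A \<inter> \<phi> ` ?B = {}"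
      unfolding 3 4 using assms(5) unfolding \<psi>(2) verts_map_mgraph .
    then have "\<phi> ` (?A - ?B) \<inter> \<phi> ` (?B - ?A) = {}" by blast
    ultimately have "inj_on \<phi> (?A \<union> ?B)"
      unfolding inj_on_Un by blast
    then show ?thesis unfolding cycles_graph_Cons[OF l] by simp
  qed
  ultimately show ?thesis by (auto simp: isomorphic_def mgraph_iso_def)
qed

lemma mgraph_iso_cycles_graph_ConsE:
  assumes "mgraph_iso \<phi> (cycles_graph (l # ls)) H" "l > 0"
  obtains R where "isomorphic (cycles_graph ls) R"
    "verts H = \<phi> ` ({0} \<times> {..<l}) \<union> verts R" "\<phi> ` ({0} \<times> {..<l}) \<inter> verts R = {}"
    "distinct (map (\<lambda>j. \<phi> (0, j)) [0..<l])"
    "edges H = cycle_edges (map (\<lambda>j. \<phi> (0, j)) [0..<l]) + edges R"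
proof -
  let ?C = "map_mgraph (map_prod Suc id) (cycles_graph ls)"
  have H: "H = map_mgraph \<phi> (cycles_graph (l # ls))" and inj: "inj_on \<phi> (verts (cycles_graph (l # ls)))"
    using assms(1) by (auto simp: mgraph_iso_def)
  have inj': "inj_on \<phi> ({0} \<times> {..<l} \<union> verts ?C)"
    using inj unfolding cycles_graph_Cons[OF assms(2)]
    by (rule inj_on_subset) auto
  have V: "verts (cycles_graph (l # ls)) = {0} \<times> {..<l} \<union> verts ?C"
    unfolding cycles_graph_Cons[OF assms(2)] by auto
  have "isomorphic (cycles_graph ls) ?C"
    by (auto simp: isomorphic_def mgraph_iso_def inj_on_def intro!: exI[of _ "map_prod Suc id"])
  then have "isomorphic (cycles_graph ls) (map_mgraph \<phi> ?C)"
    by (rule isomorphic_map_mgraph) (use inj' in \<open>auto simp: inj_on_Un\<close>)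
  moreover have "verts H = \<phi> ` ({0} \<times> {..<l}) \<union> verts (map_mgraph \<phi> ?C)"
    unfolding H verts_map_mgraph V image_Un ..
  moreover have "({0} \<times> {..<l}) \<inter> verts ?C = {}" by auto
  then have "\<phi> ` ({0} \<times> {..<l}) \<inter> verts (map_mgraph \<phi> ?C) = {}"
    unfolding verts_map_mgraph[of \<phi>]
    using inj' by (subst inj_on_image_Int[symmetric, of \<phi> "{0} \<times> {..<l} \<union> verts ?C"]) auto
  moreover have "distinct (map (\<lambda>j. \<phi> (0, j)) [0..<l])"
  proof -
    have "inj_on (\<lambda>j. \<phi> (0, j)) {0..<l}"
    proof (rule inj_onI)
      fix i j assume "i \<in> {0..<l}" "j \<in> {0..<l}" "\<phi> (0, i) = \<phi> (0, j)"
      then show "i = j" using inj_onD[OF inj', of "(0, i)" "(0, j)"] by simp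
    qed
    then show ?thesis by (simp add: distinct_map)
  qed
  moreover have "edges H = cycle_edges (map (\<lambda>j. \<phi> (0, j)) [0..<l]) + edges (map_mgraph \<phi> ?C)"
    unfolding H edges_map_mgraph unfolding cycles_graph_Cons[OF assms(2)]
    using assms(2) by (simp add: cycle_edges_map[symmetric] o_def image_mset.compositionality)
  ultimately show ?thesis by (rule that)
qed

section \<open>Translations and their orbits\<close>

text \<open>Points from \<open>2 * n\<close> on are fixed: they play the role of points at infinity.\<close>

definition shift :: "nat \<Rightarrow> nat \<Rightarrow> nat \<Rightarrow> nat" where
  "shift n i x = (if x < 2 * n then (x + i) mod (2 * n) else x)"

lemma shift_less: "x < 2 * n \<Longrightarrow> shift n i x < 2 * n"
  by (simp add: shift_def)

lemma shift_ge [simp]: "2 * n \<le> x \<Longrightarrow> shift n i x = x"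
  by (simp add: shift_def)

lemma shift_shift: "shift n i (shift n j x) = shift n (i + j) x"
  by (auto simp: shift_def mod_simps ac_simps)

lemma shift_comp: "shift n i \<circ> shift n j = shift n (i + j)"
  by (simp add: fun_eq_iff shift_shift)

lemma shift_period: "shift n (2 * n * k) = id"
  by (auto simp: shift_def)

lemma shift_two [simp]: "shift n (n + n) x = x"
  using shift_period[of n 1] by (simp add: mult_2)

lemma shift_self_self [simp]: "shift n n (shift n n x) = x"
  by (simp add: shift_shift)

lemma shift_eq_iff:
  assumes "x < 2 * n"
  shows "shift n i x = shift n j x \<longleftrightarrow> i mod (2 * n) = j mod (2 * n)"
proof -
  \<comment> \<open>Over the integers congruence is divisibility of a difference, in which
    \<open>x\<close> cancels.\<close>
  have "int ((x + i) mod (2 * n)) = int ((x + j) mod (2 * n)) \<longleftrightarrow> int (i mod (2 * n)) = int (j mod (2 * n))"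
    by (simp only: zmod_int mod_eq_dvd_iff) simp
  then show ?thesis using assms by (simp add: shift_def)
qed

lemma bij_betw_shift:
  assumes "2 * n \<le> v"
  shows "bij_betw (shift n i) {..<v} {..<v}"
proof (rule bij_betw_byWitness[where f' = "shift n (i * (2 * n - 1))"])
  \<comment> \<open>Multiplying \<open>i\<close> by \<open>2 * n - 1\<close> gives a natural number
    congruent to \<open>-i\<close>. For \<open>n = 0\<close> the subtraction truncates, but then
    every translation is the identity.\<close>
  have "shift n (i + i * (2 * n - 1)) = id"
  proof (cases "n = 0")
    case False
    then have "i + i * (2 * n - 1) = 2 * n * i"
      by (cases n) (auto simp: algebra_simps)
    then show ?thesis by (simp only: shift_period)
  qed (auto simp: shift_def)
  then show "\<forall>a\<in>{..<v}. shift n (i * (2 * n - 1)) (shift n i a) = a"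
      "\<forall>a\<in>{..<v}. shift n i (shift n (i * (2 * n - 1)) a) = a"
    by (simp_all add: shift_shift add.commute)
  have "shift n j a < v" if "a < v" for j a
    using that assms less_le_trans[of "shift n j a" "2 * n" v]
    by (cases "a < 2 * n") (simp_all add: shift_less)
  then show "shift n i ` {..<v} \<subseteq> {..<v}" "shift n (i * (2 * n - 1)) ` {..<v} \<subseteq> {..<v}"
    by auto
qed

lemma shift_cong: "i mod (2 * n) = j mod (2 * n) \<Longrightarrow> shift n i = shift n j"
  by (auto simp: fun_eq_iff shift_eq_iff) (metis shift_eq_iff shift_ge not_less)

lemma shift_reach_full:
  assumes "x < 2 * n" "y < 2 * n"
  obtains i where "i < 2 * n" "shift n i x = y"
proof
  \<comment> \<open>The summand \<open>2 * n\<close> keeps the subtraction in the natural numbers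
    exact.\<close>
  show "shift n ((y + 2 * n - x) mod (2 * n)) x = y"
    using assms by (simp add: shift_def mod_simps)
  show "(y + 2 * n - x) mod (2 * n) < 2 * n" using assms by simp
qed

text \<open>Translation by \<open>i \<ge> n\<close> is translation by \<open>n\<close> followed by
  translation by \<open>i - n\<close>. Hence for edge sets invariant under translation by
  \<open>n\<close> the first \<open>n\<close> translates already reach everything.\<close>

lemma shift_reach:
  assumes "x < 2 * n" "y < 2 * n"
  obtains i where "i < n" "shift n i x = y" | i where "i < n" "shift n i (shift n n x) = y"
proof -
  obtain i where i: "i < 2 * n" "shift n i x = y" using shift_reach_full[OF assms] .
  show thesis
  proof (cases "i < n")
    case False
    then have "shift n (i - n) (shift n n x) = y" "i - n < n"
      using i by (auto simp: shift_shift)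
    then show ?thesis using that by blast
  qed (use i that in blast)
qed

lemma shift_neq_self: "x < 2 * n \<Longrightarrow> shift n n x \<noteq> x"
  using shift_eq_iff[of x n n 0] by (auto simp: shift_def)

section \<open>Edge multisets covered by the first \<open>n\<close> translates\<close>

text \<open>Only \<open>n\<close> of the \<open>2 * n\<close> translations enter: a factor invariant
  under translation by \<open>n\<close> has just these translates. The sum of multisets keeps track
  of edges that are covered several times.\<close>

definition orbit_sum :: "nat \<Rightarrow> nat set multiset \<Rightarrow> nat set multiset" where
  "orbit_sum n M = (\<Sum>i<n. image_mset ((`) (shift n i)) M)"

lemma orbit_sum_add: "orbit_sum n (M + N) = orbit_sum n M + orbit_sum n N"
  by (simp add: orbit_sum_def sum.distrib)

lemma size_orbit_sum: "size (orbit_sum n M) = n * size M"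
  by (simp add: orbit_sum_def)

lemma set_orbit_sum: "set_mset (orbit_sum n M) = (\<Union>i<n. (`) (shift n i) ` set_mset M)"
  by (simp add: orbit_sum_def set_mset_sum)

lemma mset_eq_mset_setI:
  assumes "finite D" "D \<subseteq> set_mset M" "size M \<le> card D"
  shows "M = mset_set D"
proof -
  have "mset_set D \<subseteq># M"
    using assms(1,2) by (auto simp: subseteq_mset_def count_mset_set' Suc_le_eq)
  moreover have "\<not> mset_set D \<subset># M"
    using assms(1,3) mset_subset_size[of "mset_set D" M] by auto
  ultimately show ?thesis by (auto simp: subset_mset.less_le)
qed

text \<open>Covering and counting: if the translates reach every element of \<open>D\<close> and
  have no more edges in total than \<open>D\<close> has elements, each element is reached exactly
  once and nothing else is.\<close>

lemma orbit_sum_eq_mset_set: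
  assumes "finite D" "n * size M \<le> card D"
    and "\<And>e. e \<in> D \<Longrightarrow> \<exists>i<n. \<exists>f\<in>#M. e = shift n i ` f"
  shows "orbit_sum n M = mset_set D"
  using assms(1)
proof (rule mset_eq_mset_setI)
  show "D \<subseteq> set_mset (orbit_sum n M)"
    using assms(3) unfolding set_orbit_sum by blast
qed (use assms(2) in \<open>simp add: size_orbit_sum\<close>)

text \<open>The pairs of difference \<open>n\<close>. Taking \<open>y < n\<close> names each of them
  once; \<open>antipodal_edges_eq\<close> gives the symmetric form suited to translation.\<close>

definition antipodal_edges :: "nat \<Rightarrow> nat set set" where
  "antipodal_edges n = (\<lambda>y. {y, y + n}) ` {..<n}"

definition other_edges :: "nat \<Rightarrow> nat set set" where
  "other_edges n = {e. e \<subseteq> {..<2 * n} \<and> card e = 2} - antipodal_edges n"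

lemma antipodal_edges_eq: "antipodal_edges n = (\<lambda>y. {y, shift n n y}) ` {..<2 * n}"
proof (intro equalityI subsetI)
  fix e assume "e \<in> antipodal_edges n"
  then obtain y where "e = {y, y + n}" "y < n" by (auto simp: antipodal_edges_def)
  then show "e \<in> (\<lambda>y. {y, shift n n y}) ` {..<2 * n}" by (auto simp: shift_def)
next
  fix e assume "e \<in> (\<lambda>y. {y, shift n n y}) ` {..<2 * n}"
  then obtain y where y: "e = {y, shift n n y}" "y < 2 * n" by auto
  show "e \<in> antipodal_edges n"
  proof (cases "y < n")
    case False
    then have "e = {y - n, y - n + n}" "y - n < n" using y by (auto simp: shift_def mod_if)
    then show ?thesis by (auto simp: antipodal_edges_def)
  qed (use y in \<open>auto simp: antipodal_edges_def shift_def\<close>)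
qed

lemma antipodal_edges_props:
  shows "finite (antipodal_edges n)" "card (antipodal_edges n) = n"
    and "antipodal_edges n \<subseteq> {e. e \<subseteq> {..<2 * n} \<and> card e = 2}"
proof -
  have "inj_on (\<lambda>y. {y, y + n}) {..<n}"
    by (auto simp: inj_on_def doubleton_eq_iff)
  then show "card (antipodal_edges n) = n" by (simp add: antipodal_edges_def card_image)
qed (auto simp: antipodal_edges_def)

text \<open>Of the \<open>n * (2 * n - 1)\<close> pairs, \<open>n\<close> are antipodal. What
  remains is exactly filled by \<open>n\<close> translates of \<open>2 * n - 2\<close>
  edges.\<close>

lemma other_edges_props:
  shows "finite (other_edges n)" "card (other_edges n) = n * (2 * n - 2)"
proof -
  have fin: "finite {e. e \<subseteq> {..<2 * n} \<and> card e = 2}" by (rule finite_subset[of _ "Pow {..<2 * n}"]) auto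
  then show "finite (other_edges n)" by (simp add: other_edges_def)
  have "card (other_edges n) = card {e. e \<subseteq> {..<2 * n} \<and> card e = 2} - n"
    unfolding other_edges_def
    using card_Diff_subset[OF antipodal_edges_props(1,3), of n] by (simp add: antipodal_edges_props)
  also have "card {e. e \<subseteq> {..<2 * n} \<and> card e = 2} = n * (2 * n - 1)"
    by (simp add: n_subsets choose_two)
  finally show "card (other_edges n) = n * (2 * n - 2)"
    by (cases n) (auto simp: algebra_simps)
qed

text \<open>An antipodal pair is fixed by translation by \<open>n\<close>, so its \<open>n\<close>
  translates already run through all \<open>n\<close> antipodal pairs.\<close>

lemma orbit_sum_antipodal:
  assumes "x < 2 * n"
  shows "orbit_sum n {#{x, shift n n x}#} = mset_set (antipodal_edges n)"
proof (rule orbit_sum_eq_mset_set)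
  fix e assume "e \<in> antipodal_edges n"
  then obtain y where y: "e = {y, shift n n y}" "y < 2 * n" by (auto simp: antipodal_edges_eq)
  from assms y(2) obtain i where "i < n" "shift n i ` {x, shift n n x} = e"
  proof (cases rule: shift_reach)
    case (1 i)
    then show ?thesis using that[of i] y by (auto simp: shift_shift add.commute)
  next
    case (2 i)
    \<comment> \<open>Here \<open>y = x + n + i\<close>, so the other endpoint \<open>x + i\<close>
      is \<open>y - n\<close>, which equals \<open>y + n\<close> modulo
      \<open>2 * n\<close>.\<close>
    have "shift n i x = shift n n (shift n i (shift n n x))"
      by (simp add: shift_shift ac_simps) (simp add: shift_shift[symmetric])
    then show ?thesis using that[of i] 2 y by auto
  qed
  then show "\<exists>i<n. \<exists>f\<in>#{#{x, shift n n x}#}. e = shift n i ` f" by auto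
qed (auto simp: antipodal_edges_props)

definition star_edges :: "nat \<Rightarrow> nat \<Rightarrow> nat set set" where
  "star_edges n p = (\<lambda>y. {p, y}) ` {..<2 * n}"

text \<open>The point \<open>p\<close> is fixed, and the \<open>n\<close> translates of
  \<open>x\<close> and of \<open>x + n\<close> together exhaust the \<open>2 * n\<close>
  residues.\<close>

lemma orbit_sum_star:
  assumes "x < 2 * n" "2 * n \<le> p"
  shows "orbit_sum n {#{p, x}, {p, shift n n x}#} = mset_set (star_edges n p)"
proof (rule orbit_sum_eq_mset_set)
  have "inj_on (\<lambda>y. {p, y}) {..<2 * n}" by (auto simp: inj_on_def doubleton_eq_iff)
  then show "n * size {#{p, x}, {p, shift n n x}#} \<le> card (star_edges n p)"
    by (simp add: card_image star_edges_def)
  fix e assume "e \<in> star_edges n p"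
  then obtain y where y: "e = {p, y}" "y < 2 * n" by (auto simp: star_edges_def)
  from assms(1) y(2) show "\<exists>i<n. \<exists>f\<in>#{#{p, x}, {p, shift n n x}#}. e = shift n i ` f"
    by (cases rule: shift_reach) (use assms(2) y in auto)
qed (auto simp: star_edges_def)

text \<open>Every edge of the target is reached by a translate, and the size bound leaves no room for
  reaching one twice; exact multiplicities of the differences are never needed.\<close>

lemma orbit_sum_other:
  assumes size: "size M \<le> 2 * n - 2" and inv: "image_mset ((`) (shift n n)) M = M"
    and diff: "\<And>d. 0 < d \<Longrightarrow> d < 2 * n \<Longrightarrow> d \<noteq> n \<Longrightarrow> \<exists>u<2 * n. {u, shift n d u} \<in># M"
  shows "orbit_sum n M = mset_set (other_edges n)"
proof (rule orbit_sum_eq_mset_set)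
  show "n * size M \<le> card (other_edges n)"
    using size by (simp add: other_edges_props)
  fix e assume e: "e \<in> other_edges n"
  then obtain x y where xy: "e = {x, y}" "x \<noteq> y" "x < 2 * n" "y < 2 * n"
    by (auto simp: other_edges_def card_2_iff)
  obtain d where d: "d < 2 * n" "shift n d x = y" using shift_reach_full[OF xy(3,4)] .
  have "d \<noteq> 0" using d xy by (auto simp: shift_def)
  moreover have "d \<noteq> n" using d xy e by (auto simp: other_edges_def antipodal_edges_eq)
  ultimately obtain u where u: "u < 2 * n" "{u, shift n d u} \<in># M" using diff d by auto
  have eq: "shift n i ` {w, shift n d w} = e" if "shift n i w = x" for i w
    using that d xy by (auto simp: shift_shift add.commute)
  \<comment> \<open>Invariance of \<open>M\<close> supplies a second edge of difference
    \<open>d\<close>, starting at \<open>u + n\<close>. One of the two is carried to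
    \<open>e\<close> by a translation with index below \<open>n\<close>.\<close>
  have u': "{shift n n u, shift n d (shift n n u)} \<in># M"
  proof -
    have "shift n n ` {u, shift n d u} \<in># M" using u inv by (metis imageI set_image_mset)
    then show ?thesis by (simp add: shift_shift add.commute)
  qed
  from u(1) xy(3) show "\<exists>i<n. \<exists>f\<in>#M. e = shift n i ` f"
    by (cases rule: shift_reach) (use eq u u' in metis)+
qed (rule other_edges_props)

section \<open>The translation group and the factorization generated by one factor\<close>

text \<open>Letting the index run through all natural numbers makes closure under composition plain
  addition. The maps are restricted because elements of \<open>BijGroup\<close> are undefined
  outside the vertex set.\<close>

lemma subgroup_shifts:
  assumes "2 * n \<le> v"
  shows "subgroup (range (\<lambda>i. restrict (shift n i) {..<v})) (BijGroup {..<v})"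
proof -
  let ?s = "\<lambda>i. restrict (shift n i) {..<v}"
  have Bij: "?s i \<in> Bij {..<v}" for i
    using bij_betw_shift[OF assms] by (auto simp: Bij_def)
  have maps: "shift n i x < v" if "x < v" for i x
    using bij_betw_shift[OF assms, of i] that by (auto simp: bij_betw_def)
  have mult: "?s i \<otimes>\<^bsub>BijGroup {..<v}\<^esub> ?s j = ?s (i + j)" for i j
    using Bij by (auto simp: BijGroup_def compose_def fun_eq_iff shift_shift maps)
  have one: "\<one>\<^bsub>BijGroup {..<v}\<^esub> = ?s (2 * n * k)" for k
    by (simp add: BijGroup_def shift_period id_def)
  have inv: "inv\<^bsub>BijGroup {..<v}\<^esub> (?s i) = ?s (i * (2 * n - 1))" for i
  proof (rule group.inv_equality[OF group_BijGroup])
    have "2 * n = 0 \<or> i * (2 * n - 1) + i = 2 * n * i" by (cases n) (auto simp: algebra_simps)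
    then show "?s (i * (2 * n - 1)) \<otimes>\<^bsub>BijGroup {..<v}\<^esub> ?s i = \<one>\<^bsub>BijGroup {..<v}\<^esub>"
      using one[of i] one[of 0] unfolding mult by (auto simp: shift_def)
  qed (use Bij in \<open>auto simp: BijGroup_def\<close>)
  show ?thesis
  proof (rule group.subgroupI[OF group_BijGroup])
    show "range ?s \<subseteq> carrier (BijGroup {..<v})" using Bij by (auto simp: BijGroup_def)
  qed (auto simp: mult inv)
qed

text \<open>Raising \<open>i\<close> by one slides the window of \<open>n\<close> consecutive
  translates: the one at \<open>i\<close> leaves and the one at \<open>i + n\<close> enters. They
  coincide because \<open>H\<close> is invariant under translation by \<open>n\<close>.\<close>

lemma orbit_mset_shift:
  assumes "map_mgraph (shift n n) H = H"
  shows "image_mset (\<lambda>j. map_mgraph (shift n (i + j)) H) (mset_set {..<n}) =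
    image_mset (\<lambda>j. map_mgraph (shift n j) H) (mset_set {..<n})"
proof (induction i)
  case (Suc i)
  let ?f = "\<lambda>j. map_mgraph (shift n (i + j)) H"
  have "?f n = map_mgraph (shift n i) (map_mgraph (shift n n) H)"
    by (simp add: map_mgraph_comp shift_comp)
  then have "?f n = ?f 0" using assms by simp
  moreover have "image_mset ?f (mset_set {..<Suc n}) = add_mset (?f n) (image_mset ?f (mset_set {..<n}))"
    by (simp add: lessThan_Suc)
  moreover have "image_mset ?f (mset_set {..<Suc n}) =
      add_mset (?f 0) (image_mset (\<lambda>j. ?f (Suc j)) (mset_set {..<n}))"
    by (simp add: lessThan_Suc_eq_insert_0 image_mset_mset_set[symmetric]
        image_mset.compositionality o_def)
  ultimately show ?case using Suc by simp
qed simp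

text \<open>Reduces both claims to a single base factor \<open>H\<close>. The translations form a
  group that permutes the \<open>n\<close> translates of \<open>H\<close>, fixes the
  \<open>k\<close> points from \<open>2 * n\<close> on and acts on the residues as the cyclic group
  acts on itself.\<close>

lemma pyramidal_factorization_shift:
  assumes n: "n \<ge> 1"
    and V: "verts G = {..<2 * n + k}" "verts H = {..<2 * n + k}"
    and G: "multigraph G"
    and sum: "orbit_sum n (edges H) = edges G"
    and inv: "image_mset ((`) (shift n n)) (edges H) = edges H"
    and iso: "isomorphic F H"
  shows "pyramidal_factorization k G F
    (image_mset (\<lambda>i. map_mgraph (shift n i) H) (mset_set {..<n}))"
    (is "pyramidal_factorization k G F ?F")
proof -
  define v where "v = 2 * n + k"
  let ?s = "\<lambda>i. restrict (shift n i) {..<v}"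
  let ?H = "\<lambda>i. map_mgraph (shift n i) H"
  have bij: "bij_betw (shift n i) {..<v} {..<v}" for i
    by (rule bij_betw_shift) (simp add: v_def)
  have sum': "(\<Sum>i<n. edges (?H i)) = edges G"
    using sum by (simp add: orbit_sum_def)
  have edges_sub: "edges (?H i) \<subseteq># edges G" if "i < n" for i
    unfolding sum'[symmetric] using that by (subst sum.remove[of _ i]) auto
  have verts_H: "verts (?H i) = {..<v}" for i
    using bij[of i] by (simp add: V v_def bij_betw_def)
  have fact: "factorization G F ?F"
    unfolding factorization_def
  proof (intro conjI ballI)
    fix K assume "K \<in># ?F"
    then obtain i where i: "i < n" "K = ?H i" by auto
    show "spanning_subgraph K G"
      using G edges_sub[OF i(1)] verts_H[of i] V(1) mset_subset_eqD[OF edges_sub[OF i(1)]]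
      unfolding i(2) spanning_subgraph_def multigraph_def v_def by metis
    show "isomorphic F K"
      unfolding i(2) using iso bij[of i] by (intro isomorphic_map_mgraph) (auto simp: V v_def bij_betw_def)
  next
    show "(\<Sum>K\<in>#?F. edges K) = edges G"
      using sum' by (simp add: image_mset.compositionality o_def sum_unfold_sum_mset)
  qed
  have H_inv: "?H n = H"
    using inv verts_H[of n] V(2) by (cases H) (simp add: map_mgraph_def v_def)
  have edge_H: "e \<subseteq> {..<v}" if "e \<in># edges (?H i)" "i < n" for e i
    using mset_subset_eqD[OF edges_sub[OF that(2)] that(1)] G V(1)
    unfolding multigraph_def v_def by metis
  have aut: "automorphism_group (range ?s) {..<v} ?F"
    unfolding automorphism_group_def
  proof (intro conjI ballI)
    show "subgroup (range ?s) (BijGroup {..<v})" by (rule subgroup_shifts) (simp add: v_def)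
    fix g assume "g \<in> range ?s"
    then obtain i where g: "g = ?s i" by auto
    have "map_mgraph g (?H j) = ?H (i + j)" if "j < n" for j
    proof -
      have "map_mgraph g (?H j) = map_mgraph (shift n i) (?H j)"
        using edge_H[OF _ that] verts_H[of j] unfolding g
        by (intro map_mgraph_cong) (auto simp del: verts_map_mgraph edges_map_mgraph)
      then show ?thesis by (simp add: map_mgraph_comp shift_comp)
    qed
    then have "image_mset (map_mgraph g) ?F = image_mset (\<lambda>j. ?H (i + j)) (mset_set {..<n})"
      by (auto simp: image_mset.compositionality intro!: image_mset_cong)
    also have "\<dots> = ?F"
      using H_inv by (rule orbit_mset_shift)
    finally show "image_mset (map_mgraph g) ?F = ?F" .
  qed
  have fixed: "fixed_points (range ?s) {..<v} = {2 * n..<v}"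
  proof -
    have "(\<forall>i. shift n i x = x) \<longleftrightarrow> 2 * n \<le> x" for x
      using shift_neq_self[of x n] by (metis not_less shift_ge)
    then show ?thesis by (auto simp: fixed_points_def)
  qed
  have "sharply_transitive_on (range ?s) {..<2 * n}"
    unfolding sharply_transitive_on_def
  proof (intro ballI)
    fix x y assume "x \<in> {..<2 * n}" "y \<in> {..<2 * n}"
    then have xy: "x < 2 * n" "y < 2 * n" by auto
    then obtain i where i: "shift n i x = y" using shift_reach_full by blast
    show "\<exists>!g. g \<in> range ?s \<and> g x = y"
    proof (rule ex1I[of _ "?s i"])
      show "?s i \<in> range ?s \<and> ?s i x = y" using i xy by (auto simp: v_def)
      fix g assume "g \<in> range ?s \<and> g x = y"
      then obtain j where j: "g = ?s j" "shift n j x = y" using xy by (auto simp: v_def)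
      \<comment> \<open>Agreement at the single residue \<open>x\<close> forces the indices to be
        congruent modulo \<open>2 * n\<close>.\<close>
      then have "shift n j = shift n i"
        using i xy shift_eq_iff[OF xy(1), of j i] by (intro shift_cong) auto
      then show "g = ?s i" using j by simp
    qed
  qed
  moreover have "{..<v} - {2 * n..<v} = {..<2 * n}" by (auto simp: v_def)
  ultimately show ?thesis
    unfolding pyramidal_factorization_def
    using fact aut fixed by (intro conjI exI[of _ "range ?s"]) (auto simp: V v_def)
qed

section \<open>The cycle through infinity\<close>

text \<open>A reversal without fixed entries forces even length, since a middle entry would be its
  own image. The two halves then meet in a pair swapped by \<open>f\<close>: the edge opposite to
  infinity.\<close>

lemma map_eq_rev_split:
  assumes "map f xs = rev xs" "xs \<noteq> []" "\<And>x. x \<in> set xs \<Longrightarrow> f x \<noteq> x"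
  obtains ys zs where "xs = ys @ zs" "ys \<noteq> []" "zs \<noteq> []" "hd zs = f (last ys)" "last xs = f (hd xs)"
proof -
  have nth: "f (xs ! j) = xs ! (length xs - Suc j)" if "j < length xs" for j
    using arg_cong[OF assms(1), of "\<lambda>l. l ! j"] that by (simp add: rev_nth)
  have "even (length xs)"
  proof (rule ccontr)
    assume "odd (length xs)"
    then obtain m where "length xs = Suc (2 * m)" by (auto elim: oddE)
    then show False using nth[of m] assms(3)[of "xs ! m"] by simp
  qed
  then obtain m where m: "length xs = 2 * m" by auto
  then have "m > 0" using assms(2) by (cases m) auto
  show thesis
  proof (rule that)
    show "xs = take m xs @ drop m xs" by simp
    show "take m xs \<noteq> []" "drop m xs \<noteq> []" using m \<open>m > 0\<close> assms(2) by auto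
    have "last (take m xs) = xs ! (m - 1)"
      using m \<open>m > 0\<close> by (subst last_conv_nth) auto
    then show "hd (drop m xs) = f (last (take m xs))"
      using nth[of "m - 1"] m \<open>m > 0\<close> by (simp add: hd_drop_conv_nth)
    show "last xs = f (hd xs)"
      using nth[of 0] assms(2) by (simp add: hd_conv_nth last_conv_nth)
  qed
qed

text \<open>An automorphism of the graph that fixes \<open>p\<close> acts on the cycle through
  \<open>p\<close> as the identity or as the reflection in \<open>p\<close>. Moving the neighbours
  of \<open>p\<close> rules out the identity.\<close>

lemma map_eq_rev_of_reflection:
  assumes cyc: "distinct (p # xs)" "length xs \<ge> 2"
    and R: "set (p # xs) \<inter> verts R = {}" "\<And>e. e \<in># edges R \<Longrightarrow> e \<subseteq> verts R"
    and inv: "image_mset ((`) f) (cycle_edges (p # xs) + edges R) = cycle_edges (p # xs) + edges R"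
    and f: "inj f" "f p = p" "\<And>x. x \<in> set xs \<Longrightarrow> f x \<noteq> x"
  shows "map f xs = rev xs"
proof -
  let ?E = "cycle_edges (p # xs) + edges R"
  define L where "L = Suc (length xs)"
  \<comment> \<open>Indices are read cyclically, so \<open>p\<close> is both \<open>v 0\<close> and
    \<open>v L\<close> and the reflection becomes \<open>j \<mapsto> L - j\<close>.\<close>
  define v where "v j = (p # xs) ! (j mod L)" for j
  have L: "L \<ge> 3" using cyc by (simp add: L_def)
  have v_eq: "v i = v j \<longleftrightarrow> i mod L = j mod L" for i j
    using nth_eq_iff_index_eq[OF cyc(1), of "i mod L" "j mod L"] L by (simp add: v_def L_def)
  have v_mem: "v j \<in> set (p # xs)" for j
    unfolding v_def by (rule nth_mem) (simp add: L_def)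
  have v0: "v 0 = p" "v L = p" by (simp_all add: v_def)
  have E: "cycle_edges (p # xs) = image_mset (\<lambda>j. {v j, v (Suc j)}) (mset_set {..<L})"
    by (simp only: cycle_edges_nth list.distinct not_False_eq_True v_def L_def list.size add_0_right)
      (auto intro!: image_mset_cong)
  have edge: "{v j, v (Suc j)} \<in># ?E" for j
  proof -
    have "{v j, v (Suc j)} = {v (j mod L), v (Suc (j mod L))}"
      by (simp add: v_def mod_Suc_eq)
    moreover have "j mod L < L" using L by simp
    ultimately show ?thesis unfolding E by auto
  qed
  \<comment> \<open>No edge of \<open>R\<close> meets the cycle, so the only neighbours of a cycle
    vertex are its two cyclic ones. Positivity of \<open>k\<close> keeps \<open>k - 1\<close> a true
    predecessor; \<open>p\<close> is addressed as \<open>v L\<close>.\<close>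
  have nbr: "y = v (Suc k) \<or> y = v (k - 1)" if k: "0 < k" "k \<le> L" "{v k, y} \<in># ?E" for k y
  proof -
    have "{v k, y} \<notin># edges R"
      using R v_mem[of k] by blast
    then obtain i where i: "i < L" "{v k, y} = {v i, v (Suc i)}"
      using k(3) unfolding E by auto
    from i(2) consider "v k = v i" "y = v (Suc i)" | "v k = v (Suc i)" "y = v i"
      by (auto simp: doubleton_eq_iff)
    then show ?thesis
    proof cases
      case 1
      then have "k mod L = i mod L" by (simp only: v_eq)
      then have "v (Suc k) = v (Suc i)" by (metis v_eq mod_Suc_eq)
      then show ?thesis using 1 by simp
    next
      case 2
      then have "k mod L = Suc i mod L" by (simp only: v_eq)
      then have "k = Suc i" using k i
        by (cases "k = L"; cases "Suc i = L") auto
      then show ?thesis using 2 by simp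
    qed
  qed
  have f_edge: "{f x, f y} \<in># ?E" if "{x, y} \<in># ?E" for x y
  proof -
    have "f ` {x, y} \<in># image_mset ((`) f) ?E" using that by (metis imageI set_image_mset)
    then show ?thesis unfolding inv by simp
  qed
  \<comment> \<open>Walking along the cycle with two consecutive images known: the next image is one
    of the two neighbours of \<open>v (L - Suc j)\<close>, and injectivity excludes the one already
    taken by \<open>f (v j)\<close>.\<close>
  have "f (v j) = v (L - j) \<and> f (v (Suc j)) = v (L - Suc j)" if "Suc j \<le> L" for j
    using that
  proof (induction j)
    case 0
    have "v 1 \<in> set xs" using L by (auto simp: v_def L_def)
    have "{v L, f (v 1)} \<in># ?E" using f_edge[OF edge[of 0]] v0 f(2) by simp
    then have "f (v 1) = v (Suc L) \<or> f (v 1) = v (L - 1)" using nbr L by simp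
    moreover have "v (Suc L) = v 1" by (simp add: v_eq mod_Suc)
    ultimately show ?case using f(2,3) v0 \<open>v 1 \<in> set xs\<close> by auto
  next
    case (Suc j)
    then have IH: "f (v j) = v (L - j)" "f (v (Suc j)) = v (L - Suc j)" by auto
    have "{v (L - Suc j), f (v (Suc (Suc j)))} \<in># ?E"
      using f_edge[OF edge[of "Suc j"]] IH by simp
    then have "f (v (Suc (Suc j))) = v (Suc (L - Suc j)) \<or> f (v (Suc (Suc j))) = v (L - Suc j - 1)"
      using Suc by (intro nbr) auto
    moreover have "Suc (L - Suc j) = L - j" using Suc by simp
    moreover have "v (Suc (Suc j)) \<noteq> v j"
    proof
      assume "v (Suc (Suc j)) = v j"
      then have "Suc (Suc j) mod L = j mod L" by (simp only: v_eq)
      then show False using Suc.prems L by (cases "Suc (Suc j) = L") auto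
    qed
    then have "f (v (Suc (Suc j))) \<noteq> v (L - j)"
      using IH(1) f(1) by (metis injD)
    ultimately show ?case using IH by auto
  qed
  then have *: "f (v (Suc j)) = v (L - Suc j)" if "Suc j \<le> L" for j using that by blast
  show ?thesis
  proof (rule nth_equalityI)
    fix j assume "j < length (map f xs)"
    then have j: "j < length xs" by simp
    then have "f (xs ! j) = xs ! (length xs - Suc j)"
      using *[of j] by (simp add: v_def L_def nth_Cons')
    then show "map f xs ! j = rev xs ! j" using j by (simp add: rev_nth)
  qed simp
qed

text \<open>Transfers the starter to natural numbers and reads its first cycle from infinity. The
  condition on differences becomes the existence, for each nonzero \<open>d\<close>, of an edge
  joining some \<open>u\<close> to \<open>u + d\<close>.\<close>

lemma starter_on_nat:
  assumes n: "n \<ge> 1" and \<Sigma>: "two_starter_of_type n l ls \<Sigma>"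
  obtains R :: "nat mgraph" and xs where
    "isomorphic (cycles_graph ls) R" "distinct (2 * n # xs)" "length xs = l - 1" "l \<ge> 3"
    "set (2 * n # xs) \<inter> verts R = {}" "set (2 * n # xs) \<union> verts R = {..2 * n}"
    "image_mset ((`) (shift n n)) (cycle_edges (2 * n # xs) + edges R) = cycle_edges (2 * n # xs) + edges R"
    "\<And>d. 0 < d \<Longrightarrow> d < 2 * n \<Longrightarrow> \<exists>u<2 * n. {u, shift n d u} \<in># cycle_edges (2 * n # xs) + edges R"
proof -
  \<comment> \<open>Infinity becomes \<open>2 * n\<close>, the first point that \<open>shift\<close>
    fixes.\<close>
  define \<kappa> where "\<kappa> = case_option (2 * n) nat"
  let ?T = "map_option (\<lambda>x. (x + int n) mod int (2 * n))"
  from \<Sigma> obtain \<phi> where \<phi>: "mgraph_iso \<phi> (cycles_graph (l # ls)) \<Sigma>" "None \<in> \<phi> ` ({0} \<times> {..<l})"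
    and l: "l \<ge> 3" and simple: "simple_graph \<Sigma>"
    and V: "verts \<Sigma> = insert None (Some ` Zmod (2 * n))"
    and diff: "mset_set (Zmod (2 * n) - {0}) \<subseteq># differences (2 * n) \<Sigma>"
    and inv: "translate (2 * n) \<Sigma> (int n) = \<Sigma>"
    unfolding two_starter_of_type_def two_starter_def by auto
  have edge_V: "e \<subseteq> verts \<Sigma>" if "e \<in># edges \<Sigma>" for e
    using simple that by (auto simp: simple_graph_def multigraph_def)
  have \<kappa>_inj: "inj_on \<kappa> (verts \<Sigma>)"
    by (auto simp: V inj_on_def \<kappa>_def Zmod_def)
  define H where "H = map_mgraph \<kappa> \<Sigma>"
  have verts_H: "verts H = {..2 * n}"
  proof -
    have "nat ` {0..<int (2 * n)} = {..<2 * n}"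
      by (auto simp: image_iff intro!: bexI[of _ "int _"])
    then show ?thesis by (auto simp: H_def V \<kappa>_def Zmod_def image_image)
  qed
  have edges_H: "edges H = image_mset ((`) \<kappa>) (edges \<Sigma>)" by (simp add: H_def)
  have "mgraph_iso (\<kappa> \<circ> \<phi>) (cycles_graph (l # ls)) H"
    using \<phi>(1) \<kappa>_inj unfolding mgraph_iso_def H_def
    by (metis comp_inj_on map_mgraph_comp verts_map_mgraph)
  moreover have "l > 0" using l by simp
  ultimately obtain R where R: "isomorphic (cycles_graph ls) R"
    "verts H = (\<kappa> \<circ> \<phi>) ` ({0} \<times> {..<l}) \<union> verts R" "(\<kappa> \<circ> \<phi>) ` ({0} \<times> {..<l}) \<inter> verts R = {}"
    "distinct (map (\<lambda>j. (\<kappa> \<circ> \<phi>) (0, j)) [0..<l])"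
    "edges H = cycle_edges (map (\<lambda>j. (\<kappa> \<circ> \<phi>) (0, j)) [0..<l]) + edges R"
    by (rule mgraph_iso_cycles_graph_ConsE)
  define c where "c = map (\<lambda>j. (\<kappa> \<circ> \<phi>) (0, j)) [0..<l]"
  have set_c: "set c = (\<kappa> \<circ> \<phi>) ` ({0} \<times> {..<l})" by (auto simp: c_def)
  have len_c: "length c = l" by (simp add: c_def)
  have "\<kappa> None = 2 * n" by (simp add: \<kappa>_def)
  then have "2 * n \<in> set c" using \<phi>(2) unfolding set_c image_comp[symmetric] by (metis image_eqI)
  then obtain as bs where c: "c = as @ 2 * n # bs" by (auto simp: in_set_conv_decomp)
  have rot: "cycle_edges c = cycle_edges (2 * n # bs @ as)"
    unfolding c using cycle_edges_rotate[of as "2 * n # bs"] by simp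
  have set_rot: "set (2 * n # bs @ as) = set c" by (auto simp: c)
  have E: "cycle_edges (2 * n # bs @ as) + edges R = edges H"
    using R(5) rot by (simp add: c_def)
  show thesis
  proof (rule that)
    show "isomorphic (cycles_graph ls) R" by fact
    show "distinct (2 * n # bs @ as)" using R(4) unfolding c_def[symmetric] c by auto
    show "length (bs @ as) = l - 1" using len_c c by simp
    show "l \<ge> 3" by fact
    show "set (2 * n # bs @ as) \<inter> verts R = {}" using R(3) unfolding set_rot set_c .
    show "set (2 * n # bs @ as) \<union> verts R = {..2 * n}" using R(2) verts_H unfolding set_rot set_c by simp
    have inv_E: "image_mset ((`) ?T) (edges \<Sigma>) = edges \<Sigma>"
      using arg_cong[OF inv, of edges] by (simp add: translate_def)
    \<comment> \<open>The relabelling intertwines the two forms of translation by \<open>n\<close>,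
      which carries the invariance of the starter over to \<open>H\<close>.\<close>
    have comm: "shift n n (\<kappa> x) = \<kappa> (?T x)" if "x \<in> verts \<Sigma>" for x
    proof (cases x)
      case (Some y)
      then have y: "0 \<le> y" "y < int (2 * n)" using that by (auto simp: V Zmod_def)
      then have "nat ((y + int n) mod int (2 * n)) = (nat y + n) mod (2 * n)"
        by (simp add: nat_mod_distrib nat_add_distrib nat_mult_distrib)
      then show ?thesis using Some y by (auto simp: \<kappa>_def shift_def)
    qed (simp add: \<kappa>_def)
    have "image_mset ((`) (shift n n)) (edges H) = image_mset ((`) \<kappa>) (image_mset ((`) ?T) (edges \<Sigma>))"
      unfolding edges_H multiset.map_comp
      using edge_V comm by (intro image_mset_cong) (auto simp: image_image intro!: image_cong)
    then show "image_mset ((`) (shift n n)) (cycle_edges (2 * n # bs @ as) + edges R) = cycle_edges (2 * n # bs @ as) + edges R"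
      unfolding E inv_E edges_H .
    fix d :: nat assume d: "0 < d" "d < 2 * n"
    then have "int d \<in># mset_set (Zmod (2 * n) - {0})" by (simp add: Zmod_def)
    then have "int d \<in># differences (2 * n) \<Sigma>" using diff by (rule mset_subset_eqD[rotated])
    then obtain x y where "(x, y) \<in># mset_set {(x, y). {Some x, Some y} \<in># edges \<Sigma>}"
      and xy: "int d = (x - y) mod int (2 * n)"
      by (auto simp: differences_def)
    \<comment> \<open>On an infinite set \<open>mset_set\<close> is empty, so membership forces the
      set of pairs to be finite.\<close>
    then have e: "{Some x, Some y} \<in># edges \<Sigma>"
      by (cases "finite {(x, y). {Some x, Some y} \<in># edges \<Sigma>}") auto
    then have b: "0 \<le> x" "x < int (2 * n)" "0 \<le> y" "y < int (2 * n)"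
      using edge_V[OF e] by (auto simp: V Zmod_def)
    have "int ((nat y + d) mod (2 * n)) = x"
      using b by (simp add: zmod_int xy mod_add_right_eq)
    then have "shift n d (nat y) = nat x" "nat y < 2 * n" using b by (auto simp: shift_def)
    moreover have "\<kappa> ` {Some x, Some y} \<in># edges H" using e unfolding edges_H by (metis imageI set_image_mset)
    ultimately show "\<exists>u<2 * n. {u, shift n d u} \<in># cycle_edges (2 * n # bs @ as) + edges R"
      unfolding E by (intro exI[of _ "nat y"]) (auto simp: \<kappa>_def insert_commute)
  qed
qed

section \<open>Factorizations of complete graphs\<close>

lemma finite_two_subsets: "finite {e :: nat set. e \<subseteq> {..<v} \<and> card e = 2}"
  by (rule finite_subset[of _ "Pow {..<v}"]) auto

lemma edges_complete_mgraph: "edges (complete_mgraph v) = mset_set {e. e \<subseteq> {..<v} \<and> card e = 2}"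
  and verts_complete_mgraph: "verts (complete_mgraph v) = {..<v}"
  by (simp_all add: complete_mgraph_def)

lemma edges_complete_mgraph_even:
  "edges (complete_mgraph (2 * n)) = mset_set (other_edges n) + mset_set (antipodal_edges n)"
proof -
  have "{e. e \<subseteq> {..<2 * n} \<and> card e = 2} = other_edges n \<union> antipodal_edges n"
    using antipodal_edges_props(3)[of n] by (auto simp: other_edges_def)
  then show ?thesis
    by (simp only: edges_complete_mgraph)
      (rule mset_set_Union, auto simp: other_edges_props antipodal_edges_props other_edges_def)
qed

text \<open>The last summand is the 1-factor to be removed. The first three are the orbit sums of
  the three kinds of edges in the base factor: those inside the residues and those at each of the
  two fixed points.\<close>

lemma edges_complete_mgraph_even_add_2:
  fixes n :: nat
  defines "p \<equiv> 2 * n" and "q \<equiv> 2 * n + 1"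
  shows "edges (complete_mgraph (2 * n + 2)) =
    mset_set (other_edges n) + mset_set (star_edges n p) + mset_set (star_edges n q)
      + mset_set (insert {p, q} (antipodal_edges n))"
proof -
  have sub: "e \<subseteq> {..<2 * n}" if "e \<in> other_edges n \<or> e \<in> antipodal_edges n" for e
    using that antipodal_edges_props(3)[of n] by (auto simp: other_edges_def)
  have not_sub: "\<not> e \<subseteq> {..<2 * n}" if "e \<in> star_edges n p \<or> e \<in> star_edges n q \<or> e = {p, q}" for e
    using that by (auto simp: star_edges_def p_def q_def)
  have "{e. e \<subseteq> {..<2 * n + 2} \<and> card e = 2} =
    other_edges n \<union> star_edges n p \<union> star_edges n q \<union> insert {p, q} (antipodal_edges n)" (is "?L = ?R")
  proof (intro equalityI subsetI)
    fix e assume "e \<in> ?L"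
    then obtain x y where e: "e = {x, y}" "x < y" "y < 2 * n + 2"
      by (auto simp: card_2_iff) (metis insert_commute linorder_neqE_nat)
    consider "y < 2 * n" | "y = p" | "y = q" "x < 2 * n" | "y = q" "x = p"
      using e unfolding p_def q_def by linarith
    then show "e \<in> ?R"
      using e by cases (auto simp: other_edges_def star_edges_def p_def insert_commute)
  next
    fix e assume "e \<in> ?R"
    then consider "e \<in> other_edges n" | "e \<in> antipodal_edges n" | "e \<in> star_edges n p \<or> e \<in> star_edges n q \<or> e = {p, q}"
      by blast
    then show "e \<in> ?L"
    proof cases
      case 1
      then show ?thesis using sub[of e] by (auto simp: other_edges_def)
    next
      case 2
      then show ?thesis using sub[of e] antipodal_edges_props(3)[of n] by auto
    qed (auto simp: star_edges_def p_def q_def)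
  qed
  moreover have "mset_set ?R = mset_set (other_edges n \<union> star_edges n p \<union> star_edges n q)
      + mset_set (insert {p, q} (antipodal_edges n))"
  proof (rule mset_set_Union)
    show "(other_edges n \<union> star_edges n p \<union> star_edges n q) \<inter> insert {p, q} (antipodal_edges n) = {}"
      using sub not_sub by (auto simp: other_edges_def star_edges_def doubleton_eq_iff p_def q_def)
  qed (auto simp: other_edges_props antipodal_edges_props star_edges_def)
  moreover have "mset_set (other_edges n \<union> star_edges n p \<union> star_edges n q) =
      mset_set (other_edges n \<union> star_edges n p) + mset_set (star_edges n q)"
    using sub not_sub
    by (intro mset_set_Union) (auto simp: other_edges_props star_edges_def doubleton_eq_iff p_def q_def)
  moreover have "mset_set (other_edges n \<union> star_edges n p) =
      mset_set (other_edges n) + mset_set (star_edges n p)"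
    using sub not_sub
    by (intro mset_set_Union) (auto simp: other_edges_props star_edges_def)
  ultimately show ?thesis by (simp only: edges_complete_mgraph)
qed

lemma one_factor_complete_mgraphI:
  assumes "finite S" "\<And>e. e \<in> S \<Longrightarrow> e \<subseteq> {..<v} \<and> card e = 2"
    and "\<And>x. x < v \<Longrightarrow> \<exists>!e. e \<in> S \<and> x \<in> e"
  shows "one_factor \<lparr>verts = {..<v}, edges = mset_set S\<rparr> (complete_mgraph v)"
proof -
  have "card {e \<in> S. x \<in> e} = 1" if x: "x < v" for x
  proof -
    from assms(3)[OF x] obtain e where "{e \<in> S. x \<in> e} = {e}" by blast
    then show ?thesis by simp
  qed
  moreover have "mset_set S \<subseteq># mset_set {e. e \<subseteq> {..<v} \<and> card e = 2}"
    using assms(1,2) finite_two_subsets by (subst msubset_mset_set_iff) auto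
  ultimately show ?thesis
    using assms(1,2)
    by (auto simp: one_factor_def spanning_subgraph_def multigraph_def verts_complete_mgraph
        edges_complete_mgraph regular_graph_def degree_in_def filter_mset_mset_set)
qed

lemma antipodal_edges_ex1:
  assumes "x < 2 * n"
  shows "\<exists>!e. e \<in> antipodal_edges n \<and> x \<in> e"
  using assms unfolding antipodal_edges_eq
  by (intro ex1I[of _ "{x, shift n n x}"]) (auto simp: insert_commute)

section \<open>The two base factors obtained from a starter\<close>

theorem theorem2p11:
  fixes n l :: nat and ls :: "nat list" and \<Sigma> :: "int option mgraph"
  assumes "n \<ge> 1"
    and "two_starter_of_type n l ls \<Sigma>"
  shows "(\<exists>I \<F>. one_factor I (complete_mgraph (2 * n + 2)) \<and>
            pyramidal_factorization 2 (remove_edges (complete_mgraph (2 * n + 2)) I)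
              (cycles_graph ((l + 1) # ls)) \<F>) \<and>
         (\<exists>J \<F>. one_factor J (complete_mgraph (2 * n)) \<and>
            regular_factorization (add_edges (complete_mgraph (2 * n)) J)
              (cycles_graph ((l - 1) # ls)) \<F>)"
proof -
  obtain R :: "nat mgraph" and xs where
    R: "isomorphic (cycles_graph ls) R" and xs: "distinct (2 * n # xs)" "length xs = l - 1" "l \<ge> 3"
    and disj: "set (2 * n # xs) \<inter> verts R = {}" and un: "set (2 * n # xs) \<union> verts R = {..2 * n}"
    and inv: "image_mset ((`) (shift n n)) (cycle_edges (2 * n # xs) + edges R) = cycle_edges (2 * n # xs) + edges R"
    and diff: "\<And>d. 0 < d \<Longrightarrow> d < 2 * n \<Longrightarrow> \<exists>u<2 * n. {u, shift n d u} \<in># cycle_edges (2 * n # xs) + edges R"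
    by (rule starter_on_nat[OF assms]) (rule that)
  let ?s = "shift n n"
  \<comment> \<open>the points \<open>\<infinity>\<close> and \<open>\<infinity>'\<close>\<close>
  define p where "p = 2 * n"
  define q where "q = 2 * n + 1"
  have un': "set xs \<union> verts R = {..<2 * n}"
  proof -
    have "2 * n \<notin> set xs \<union> verts R" using disj xs(1) by auto
    then have "set xs \<union> verts R = (set (2 * n # xs) \<union> verts R) - {2 * n}" by auto
    also have "\<dots> = {..<2 * n}" unfolding un by auto
    finally show ?thesis .
  qed
  then have xs_less: "x < 2 * n" if "x \<in> set xs" for x using that by blast
  note R_edges = isomorphic_cycles_graph_edges[OF R]
  have inj_s: "inj ?s" by (metis injI shift_self_self)
  have no_fix: "?s x \<noteq> x" if "x \<in> set xs" for x using shift_neq_self[OF xs_less[OF that]] .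
  have rev: "map ?s xs = rev xs"
  proof (rule map_eq_rev_of_reflection[OF xs(1) _ disj R_edges(3) inv inj_s])
    show "length xs \<ge> 2" using xs(2,3) by simp
  qed (simp_all add: no_fix)
  have "xs \<noteq> []" using xs(2,3) by auto
  then obtain ys zs where yz: "xs = ys @ zs" "ys \<noteq> []" "zs \<noteq> []" "hd zs = ?s (last ys)" "last xs = ?s (hd xs)"
    using map_eq_rev_split[OF rev _ no_fix] by blast
  define a where "a = hd xs"
  define c where "c = last ys"
  \<comment> \<open>The edges that the starter shares with both modified graphs: all but the two at
    infinity and the edge \<open>{c, c + n}\<close>.\<close>
  define M where "M = path_edges ys + path_edges zs + edges R"
  have ac: "a < 2 * n" "c < 2 * n"
    using yz xs_less by (auto simp: a_def c_def)
  have ends: "hd ys = a" "last zs = ?s a" "last ys = c" "hd zs = ?s c"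
    using yz by (auto simp: a_def c_def)
  have E: "cycle_edges (p # xs) + edges R = M + {#{p, a}, {p, ?s a}#} + {#{c, ?s c}#}"
    using yz(2,3) path_edges_append[of "[p]" "ys @ zs @ [p]"]
    by (simp add: cycle_edges_def M_def yz(1) path_edges_append ends insert_commute)
  \<comment> \<open>Inserting \<open>q\<close> between \<open>ys\<close> and \<open>zs\<close>
    subdivides the edge \<open>{c, c + n}\<close>.\<close>
  have E1: "cycle_edges (p # ys @ q # zs) + edges R =
      M + {#{p, a}, {p, ?s a}#} + {#{q, c}, {q, ?s c}#}"
    using yz(2,3) path_edges_append[of "[p]" "ys @ q # zs @ [p]"] path_edges_append[of "[q]" "zs @ [p]"]
    by (simp add: cycle_edges_def M_def path_edges_append ends insert_commute)
  \<comment> \<open>Without infinity the list closes up by the edge from \<open>a + n\<close> to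
    \<open>a\<close>. For \<open>l = 3\<close> one has \<open>c = a\<close>, and the two antipodal
    edges form a digon.\<close>
  have E2: "cycle_edges xs + edges R = M + {#{c, ?s c}#} + {#{a, ?s a}#}"
    using yz(2,3) by (simp add: cycle_edges_def M_def yz(1) path_edges_append ends insert_commute)
  \<comment> \<open>The starter has as many edges as vertices, namely \<open>2 * n + 1\<close>, and
    three of them are left out of \<open>M\<close>.\<close>
  have size_M: "size M \<le> 2 * n - 2"
  proof -
    have "card (set (p # xs)) + card (verts R) = card {..2 * n}"
      unfolding un[symmetric] p_def using disj R_edges(1) by (subst card_Un_disjoint) auto
    moreover have "card (set (p # xs)) = length (p # xs)"
      using xs(1) unfolding p_def by (rule distinct_card)
    moreover have "size (cycle_edges (p # xs)) = length (p # xs)" by (rule size_cycle_edges) simp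
    ultimately have "size (cycle_edges (p # xs) + edges R) = 2 * n + 1" using R_edges(2) by simp
    then show ?thesis unfolding E by simp
  qed
  have p_fix: "?s p = p" "?s q = q" by (simp_all add: p_def q_def)
  have inv_M: "image_mset ((`) ?s) M = M"
    using inv unfolding p_def[symmetric] E by (simp add: p_fix insert_commute add_mset_commute)
  \<comment> \<open>The edges left out either meet infinity or have difference \<open>n\<close>, so
    an edge realizing another difference \<open>d\<close> lies in \<open>M\<close>.\<close>
  have diff_M: "\<exists>u<2 * n. {u, shift n d u} \<in># M" if d: "0 < d" "d < 2 * n" "d \<noteq> n" for d
  proof -
    obtain u where u: "u < 2 * n" "{u, shift n d u} \<in># M + {#{p, a}, {p, ?s a}#} + {#{c, ?s c}#}"
      using diff[OF d(1,2)] unfolding p_def[symmetric] E by blast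
    have "p \<noteq> u" "p \<noteq> shift n d u" using u(1) shift_less[OF u(1), of d] unfolding p_def by linarith+
    then have "{u, shift n d u} \<noteq> {p, x}" for x by (metis insertE insertI1 singletonD)
    moreover have "{u, shift n d u} \<noteq> {c, ?s c}"
    proof
      assume "{u, shift n d u} = {c, ?s c}"
      then have "shift n d u = shift n n u" by (metis doubleton_eq_iff shift_self_self)
      then show False using shift_eq_iff[OF u(1), of d n] d by simp
    qed
    ultimately have "{u, shift n d u} \<in># M"
      using u(2) by (simp only: union_iff set_mset_add_mset_insert set_mset_empty insert_iff empty_iff simp_thms)
    with u(1) show ?thesis by blast
  qed
  have sum_M: "orbit_sum n M = mset_set (other_edges n)"
    using size_M inv_M diff_M by (rule orbit_sum_other)
  have two_edges: "e \<subseteq> {..<v} \<and> card e = 2" if "e \<in># edges (complete_mgraph v)" for e v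
    using that finite_two_subsets by (simp add: edges_complete_mgraph)
  let ?N = "antipodal_edges n"
  have N: "e \<subseteq> {..<2 * n} \<and> card e = 2" if "e \<in> ?N" for e
    using antipodal_edges_props(3) that by blast
  have "\<exists>I \<F>. one_factor I (complete_mgraph (2 * n + 2)) \<and>
      pyramidal_factorization 2 (remove_edges (complete_mgraph (2 * n + 2)) I) (cycles_graph ((l + 1) # ls)) \<F>"
  proof (intro exI conjI)
    let ?I = "\<lparr>verts = {..<2 * n + 2}, edges = mset_set (insert {p, q} ?N)\<rparr>"
    let ?H = "\<lparr>verts = set (p # ys @ q # zs) \<union> verts R, edges = cycle_edges (p # ys @ q # zs) + edges R\<rparr>"
    let ?G = "remove_edges (complete_mgraph (2 * n + 2)) ?I"
    have pq_N: "p \<notin> e" "q \<notin> e" if "e \<in> ?N" for e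
      using N[OF that] by (auto simp: p_def q_def)
    show "one_factor ?I (complete_mgraph (2 * n + 2))"
    proof (rule one_factor_complete_mgraphI)
      fix x assume "x < 2 * n + 2"
      then consider "x < 2 * n" | "x = p" | "x = q" unfolding p_def q_def by linarith
      then show "\<exists>!e. e \<in> insert {p, q} ?N \<and> x \<in> e"
      proof cases
        case 1
        then have "x \<notin> {p, q}" by (simp add: p_def q_def)
        then show ?thesis using antipodal_edges_ex1[OF 1] by (metis insert_iff)
      qed (use pq_N in \<open>intro ex1I[of _ "{p, q}"]; metis insert_iff\<close>)+
    next
      fix e assume "e \<in> insert {p, q} ?N"
      then consider "e = {p, q}" | "e \<in> ?N" by blast
      then show "e \<subseteq> {..<2 * n + 2} \<and> card e = 2"
      proof cases
        case 1
        show ?thesis unfolding 1 by (simp add: p_def q_def)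
      next
        case 2
        have "{..<2 * n} \<subseteq> {..<2 * n + 2}" by simp
        then show ?thesis using N[OF 2] by (meson subset_trans)
      qed
    qed (simp add: antipodal_edges_props)
    have G: "edges ?G = mset_set (other_edges n) + mset_set (star_edges n p) + mset_set (star_edges n q)"
      unfolding remove_edges_def mgraph.select_convs edges_complete_mgraph_even_add_2 p_def q_def
      by (rule add_diff_cancel_right')
    show "pyramidal_factorization 2 ?G (cycles_graph ((l + 1) # ls))
        (image_mset (\<lambda>i. map_mgraph (shift n i) ?H) (mset_set {..<n}))"
    proof (rule pyramidal_factorization_shift)
      show "verts ?G = {..<2 * n + 2}" by (simp add: remove_edges_def verts_complete_mgraph)
      have "set (p # ys @ q # zs) \<union> verts R = insert p (insert q (set xs \<union> verts R))"
        unfolding yz(1) set_append list.set by blast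
      also have "\<dots> = {..<2 * n + 2}" unfolding un' by (auto simp: p_def q_def)
      finally show "verts ?H = {..<2 * n + 2}" by simp
      show "multigraph ?G"
        using two_edges unfolding multigraph_def remove_edges_def mgraph.select_convs verts_complete_mgraph
        by (meson finite_lessThan in_diffD)
      \<comment> \<open>\<open>M\<close> contributes the pairs of difference other than
        \<open>n\<close>, and the two edges at \<open>p\<close> and at \<open>q\<close> contribute
        the two stars. This leaves \<open>{p, q}\<close> and the antipodal pairs, which make up
        \<open>?I\<close>.\<close>
      show "orbit_sum n (edges ?H) = edges ?G"
        unfolding G mgraph.select_convs E1 orbit_sum_add
        using ac by (simp only: sum_M orbit_sum_star p_def q_def)
      show "image_mset ((`) ?s) (edges ?H) = edges ?H"
        unfolding mgraph.select_convs E1 by (simp add: inv_M p_fix add_mset_commute)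
      have "length (p # ys @ q # zs) = l + 1" using xs yz(1) by simp
      moreover have "q \<notin> set (2 * n # xs) \<union> verts R"
        unfolding un by (simp add: q_def)
      then have "distinct (p # ys @ q # zs)" "set (p # ys @ q # zs) \<inter> verts R = {}"
        using xs(1) disj unfolding p_def[symmetric] yz(1) by simp_all
      ultimately show "isomorphic (cycles_graph ((l + 1) # ls)) ?H"
        using R by (intro isomorphic_cycles_graph_ConsI) simp_all
    qed fact
  qed
  moreover have "\<exists>J \<F>. one_factor J (complete_mgraph (2 * n)) \<and>
      regular_factorization (add_edges (complete_mgraph (2 * n)) J) (cycles_graph ((l - 1) # ls)) \<F>"
    unfolding regular_factorization_def
  proof (intro exI conjI)
    let ?J = "\<lparr>verts = {..<2 * n}, edges = mset_set ?N\<rparr>"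
    let ?H = "\<lparr>verts = set xs \<union> verts R, edges = cycle_edges xs + edges R\<rparr>"
    let ?G = "add_edges (complete_mgraph (2 * n)) ?J"
    show "one_factor ?J (complete_mgraph (2 * n))"
      using N antipodal_edges_ex1 antipodal_edges_props(1) by (intro one_factor_complete_mgraphI) auto
    show "pyramidal_factorization 0 ?G (cycles_graph ((l - 1) # ls))
        (image_mset (\<lambda>i. map_mgraph (shift n i) ?H) (mset_set {..<n}))"
    proof (rule pyramidal_factorization_shift)
      show "verts ?G = {..<2 * n + 0}" by (simp add: add_edges_def verts_complete_mgraph)
      show "verts ?H = {..<2 * n + 0}" using un' by simp
      show "multigraph ?G"
      proof -
        have "e \<subseteq> {..<2 * n} \<and> card e = 2" if "e \<in># edges (complete_mgraph (2 * n)) + mset_set ?N" for e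
        proof -
          have "e \<in># edges (complete_mgraph (2 * n)) \<or> e \<in> ?N"
            using that by (simp add: antipodal_edges_props)
          then show ?thesis using two_edges N by blast
        qed
        then show ?thesis
          unfolding multigraph_def add_edges_def mgraph.select_convs verts_complete_mgraph by simp
      qed
      \<comment> \<open>Each of the edges \<open>{c, c + n}\<close> and \<open>{a, a + n}\<close>
        sweeps out all antipodal pairs once, so these are covered twice, as doubling the edges of
        \<open>?J\<close> demands.\<close>
      show "orbit_sum n (edges ?H) = edges ?G"
        unfolding add_edges_def mgraph.select_convs E2 orbit_sum_add edges_complete_mgraph_even
        using ac by (simp only: sum_M orbit_sum_antipodal)
      show "image_mset ((`) ?s) (edges ?H) = edges ?H"
        unfolding mgraph.select_convs E2 by (simp add: inv_M insert_commute)
      show "isomorphic (cycles_graph ((l - 1) # ls)) ?H"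
      proof (rule isomorphic_cycles_graph_ConsI)
        show "distinct xs" "set xs \<inter> verts R = {}" using xs(1) disj by simp_all
      qed (fact \<open>xs \<noteq> []\<close> xs(2) R)+
    qed fact
  qed
  ultimately show ?thesis ..
qed

end
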